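(* Let $\mathfrak{A}$ and $\mathfrak{B}$ be two connected monounary algebras. If $\mathfrak{A}$ and $\mathfrak{B}$ have isomorphic cores, then $$d_{\mathfrak{g}}(\mathfrak{A},\mathfrak{B})\le d(\mathfrak{A})+d(\mathfrak{B})-1.$$ If the cores of $\mathfrak{A}$ and $\mathfrak{B}$ are not isomorphic, then $$d_{\mathfrak{g}}(\mathfrak{A},\mathfrak{B})=d(\mathfrak{A})+d(\mathfrak{B}).$$
   Context: A monounary algebra is a structure $\mathfrak{A}=\langle A,f\rangle$ with $A$ a nonempty set and $f:A\to A$ one unary operation. It is connected if for all $a,b\in A$ there are $k,l\in\omega$ with $f^k(a)=f^l(b)$ (where $f^0(a)=a$, and $0\in\omega$). $\mathfrak{C}_\omega$ denotes the monounary algebra $\omega$ with the successor function; for $0\neq n\in\omega$, $\mathfrak{C}_n$ denotes the cycle of length $n$, i.e. $\mathbb{Z}/n\mathbb{Z}$ with $x\mapsto x+1$. Every connected monounary algebra has a subalgebra isomorphic either to $\mathfrak{C}_\omega$ or to $\mathfrak{C}_n$ for some nonzero $n\in\omega$; such a subalgebra is called a core, and it is unique up to isomorphism. Let $\mathrm{K}$ be the class of all monounary algebras. A subalgebra $\mathfrak{A}$ of $\mathfrak{B}$ is large in $\mathfrak{B}$ if there is $b\in B$ such that $A\cup\{b\}$ generates $\mathfrak{B}$. The network $\mathcal{N}(\mathrm{K})$ is the graph whose vertices are the members of $\mathrm{K}$, with two types of edges: red edges joining isomorphic members of $\mathrm{K}$, and blue edges joining two members of $\mathrm{K}$ if one of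 them is a large subalgebra of the other. A path is a finite sequence of edges in which any two consecutive edges share a common vertex; its blue-length is the number of its blue edges. The generator distance $d_{\mathfrak{g}}(\mathfrak{A},\mathfrak{B})\in\omega\cup\{\infty\}$ is the minimum blue-length of a path connecting $\mathfrak{A}$ and $\mathfrak{B}$ in $\mathcal{N}(\mathrm{K})$, and is $\infty$ if there is no such path. $d(\mathfrak{A})$ denotes the minimum number of generators of $\mathfrak{A}$, with $d(\mathfrak{A})=\infty$ if $\mathfrak{A}$ is not finitely generated. Arithmetic with $\infty$ is the natural one (in particular $\infty-1=\infty$). *)

theory Defs
  imports Complex_Main "HOL-Library.Extended_Nat"
begin

section \<open>Monounary algebras\<close>

text \<open>
  Only the values of \<^term>\<open>oper\<close> on the carrier are meaningful.  Records that differ only off the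
  carrier are isomorphic via the identity, so they are at generator distance 0.
\<close>

record 'a monounary =
  carrier :: "'a set"
  oper :: "'a \<Rightarrow> 'a"

definition monounary_algebra :: "'a monounary \<Rightarrow> bool" where
  "monounary_algebra A \<longleftrightarrow> carrier A \<noteq> {} \<and> oper A ` carrier A \<subseteq> carrier A"

definition connected_algebra :: "'a monounary \<Rightarrow> bool" where
  "connected_algebra A \<longleftrightarrow>
     (\<forall>a\<in>carrier A. \<forall>b\<in>carrier A. \<exists>k l. (oper A ^^ k) a = (oper A ^^ l) b)"

definition isomorphic :: "'a monounary \<Rightarrow> 'b monounary \<Rightarrow> bool" where
  "isomorphic A B \<longleftrightarrow>
     (\<exists>h. bij_betw h (carrier A) (carrier B) \<and> (\<forall>x\<in>carrier A. h (oper A x) = oper B (h x)))"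

definition subalgebra :: "'a monounary \<Rightarrow> 'a monounary \<Rightarrow> bool" where
  "subalgebra A B \<longleftrightarrow>
     monounary_algebra A \<and> carrier A \<subseteq> carrier B \<and> (\<forall>x\<in>carrier A. oper A x = oper B x)"

text \<open>Intended for \<open>S \<subseteq> carrier A\<close> only; otherwise the intersection is over the empty family.\<close>

definition generated :: "'a monounary \<Rightarrow> 'a set \<Rightarrow> 'a set" where
  "generated A S = (\<lambda>T. T \<subseteq> carrier A \<and> oper A ` T \<subseteq> T) hull S"

definition generates :: "'a monounary \<Rightarrow> 'a set \<Rightarrow> bool" where
  "generates A S \<longleftrightarrow> S \<subseteq> carrier A \<and> generated A S = carrier A"

text \<open>The infimum over the empty set is \<open>\<infinity>\<close>, which covers algebras that are not finitely generated.\<close>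

definition min_generators :: "'a monounary \<Rightarrow> enat" where
  "min_generators A = (INF S\<in>{S. finite S \<and> generates A S}. enat (card S))"

definition C_omega :: "nat monounary" where
  "C_omega = \<lparr>carrier = UNIV, oper = Suc\<rparr>"

definition C_cycle :: "nat \<Rightarrow> nat monounary" where
  "C_cycle n = \<lparr>carrier = {0..<n}, oper = (\<lambda>x. (x + 1) mod n)\<rparr>"

definition is_core :: "'a monounary \<Rightarrow> 'a monounary \<Rightarrow> bool" where
  "is_core C A \<longleftrightarrow>
     subalgebra C A \<and> (isomorphic C C_omega \<or> (\<exists>n. n \<noteq> 0 \<and> isomorphic C (C_cycle n)))"

definition isomorphic_cores :: "'a monounary \<Rightarrow> 'b monounary \<Rightarrow> bool" where
  "isomorphic_cores A B \<longleftrightarrow> (\<exists>C D. is_core C A \<and> is_core D B \<and> isomorphic C D)"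

section \<open>The network and the generator distance\<close>

text \<open>
  The vertices of the network are the monounary algebras whose carrier is a subset of a type
  \<^typ>\<open>'u\<close>.  Provided \<^typ>\<open>'u\<close> is infinite, this does not affect distances: red edges
  preserve cardinality, and the two ends of a blue edge differ by countably many elements, so up to
  isomorphism all vertices on a path starting in \<^typ>\<open>'u\<close> live in \<^typ>\<open>'u\<close>.
  Lemma \<open>generator_distance_universe\<close> below makes this precise.
\<close>

definition large_subalgebra :: "'u monounary \<Rightarrow> 'u monounary \<Rightarrow> bool" where
  "large_subalgebra A B \<longleftrightarrow> subalgebra A B \<and> (\<exists>b\<in>carrier B. generates B (insert b (carrier A)))"

datatype colour = Red | Blue

definition network_edge :: "colour \<Rightarrow> 'u monounary \<Rightarrow> 'u monounary \<Rightarrow> bool" where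
  "network_edge c X Y \<longleftrightarrow> monounary_algebra X \<and> monounary_algebra Y \<and>
     (case c of Red \<Rightarrow> isomorphic X Y
              | Blue \<Rightarrow> large_subalgebra X Y \<or> large_subalgebra Y X)"

text \<open>An edge on a path is recorded by its colour and the vertex it leads to.\<close>

fun network_path ::
  "'u monounary \<Rightarrow> (colour \<times> 'u monounary) list \<Rightarrow> 'u monounary \<Rightarrow> bool" where
  "network_path X [] Y \<longleftrightarrow> X = Y"
| "network_path X ((c, Z) # es) Y \<longleftrightarrow> network_edge c X Z \<and> network_path Z es Y"

definition blue_length :: "(colour \<times> 'u monounary) list \<Rightarrow> nat" where
  "blue_length es = length (filter (\<lambda>e. fst e = Blue) es)"

definition generator_distance :: "'u monounary \<Rightarrow> 'u monounary \<Rightarrow> enat" where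
  "generator_distance A B = (INF es\<in>{es. network_path A es B}. enat (blue_length es))"

section \<open>Independence of the choice of the infinite type\<close>

lemma isomorphic_sym: "isomorphic A B \<Longrightarrow> isomorphic B A"
  if "monounary_algebra A"
proof -
  assume "isomorphic A B"
  then obtain h where h: "bij_betw h (carrier A) (carrier B)"
    "\<And>x. x \<in> carrier A \<Longrightarrow> h (oper A x) = oper B (h x)"
    unfolding isomorphic_def by blast
  let ?g = "inv_into (carrier A) h"
  have "?g (oper B y) = oper A (?g y)" if "y \<in> carrier B" for y
  proof -
    have m: "?g y \<in> carrier A" "h (?g y) = y"
      using h(1) that by (auto simp: bij_betw_def inv_into_into f_inv_into_f)
    have "oper A (?g y) \<in> carrier A"
      using m(1) \<open>monounary_algebra A\<close> unfolding monounary_algebra_def by blast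
    then show ?thesis
      using h m by (metis bij_betw_inv_into_left)
  qed
  then show ?thesis
    using bij_betw_inv_into[OF h(1)] unfolding isomorphic_def by blast
qed

lemma isomorphic_trans: "isomorphic A B \<Longrightarrow> isomorphic B C \<Longrightarrow> isomorphic A C"
proof -
  assume "isomorphic A B" "isomorphic B C"
  then obtain h g where h: "bij_betw h (carrier A) (carrier B)"
    "\<And>x. x \<in> carrier A \<Longrightarrow> h (oper A x) = oper B (h x)"
    and g: "bij_betw g (carrier B) (carrier C)"
    "\<And>x. x \<in> carrier B \<Longrightarrow> g (oper B x) = oper C (g x)"
    unfolding isomorphic_def by blast
  have "(g \<circ> h) (oper A x) = oper C ((g \<circ> h) x)" if "x \<in> carrier A" for x
    using h g that by (metis bij_betwE comp_apply)
  then show ?thesis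
    using bij_betw_trans[OF h(1) g(1)] unfolding isomorphic_def by blast
qed

definition image_algebra :: "('a \<Rightarrow> 'b) \<Rightarrow> 'a monounary \<Rightarrow> 'b monounary" where
  "image_algebra h A =
     \<lparr>carrier = h ` carrier A, oper = (\<lambda>y. h (oper A (inv_into (carrier A) h y)))\<rparr>"

lemma image_algebra_carrier [simp]: "carrier (image_algebra h A) = h ` carrier A"
  by (simp add: image_algebra_def)

lemma image_algebra_oper:
  "inj_on h (carrier A) \<Longrightarrow> x \<in> carrier A \<Longrightarrow> oper (image_algebra h A) (h x) = h (oper A x)"
  by (simp add: image_algebra_def)

lemma image_algebra:
  assumes "monounary_algebra A" "inj_on h (carrier A)"
  shows "monounary_algebra (image_algebra h A)" "isomorphic A (image_algebra h A)"
proof -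
  show "monounary_algebra (image_algebra h A)"
    using assms image_algebra_oper[OF assms(2)] unfolding monounary_algebra_def by fastforce
  show "isomorphic A (image_algebra h A)"
    using assms image_algebra_oper[OF assms(2)] unfolding isomorphic_def bij_betw_def by fastforce
qed

lemma generates_image:
  assumes "monounary_algebra A" "inj_on h (carrier A)" "generates A S"
  shows "generates (image_algebra h A) (h ` S)"
proof -
  have S: "S \<subseteq> carrier A" "generated A S = carrier A"
    using assms(3) unfolding generates_def by auto
  have "h ` carrier A \<subseteq> T"
    if T: "T \<subseteq> h ` carrier A" "oper (image_algebra h A) ` T \<subseteq> T" "h ` S \<subseteq> T" for T
  proof -
    let ?U = "{x \<in> carrier A. h x \<in> T}"
    have "oper A x \<in> ?U" if "x \<in> ?U" for x
    proof -
      have "oper (image_algebra h A) (h x) \<in> T" using that T(2) by blast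
      then show ?thesis
        using that assms(1) image_algebra_oper[OF assms(2)] unfolding monounary_algebra_def by auto
    qed
    then have "?U \<subseteq> carrier A \<and> oper A ` ?U \<subseteq> ?U" "S \<subseteq> ?U"
      using S(1) T(3) by blast+
    then have "generated A S \<subseteq> ?U"
      unfolding generated_def by (rule_tac hull_minimal)
    then show ?thesis using S(2) by blast
  qed
  moreover have "oper (image_algebra h A) ` (h ` carrier A) \<subseteq> h ` carrier A"
    using image_algebra(1)[OF assms(1,2)] unfolding monounary_algebra_def by simp
  ultimately have "generated (image_algebra h A) (h ` S) = h ` carrier A"
    using S(1) unfolding generated_def by (rule_tac hull_unique) auto
  then show ?thesis
    using S(1) unfolding generates_def by auto
qed

lemma large_subalgebra_image:
  assumes "large_subalgebra A B" "monounary_algebra B" "inj_on h (carrier B)"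
  shows "large_subalgebra (image_algebra h A) (image_algebra h B)"
proof -
  from assms(1) obtain b where A: "subalgebra A B" and
    b: "b \<in> carrier B" "generates B (insert b (carrier A))"
    unfolding large_subalgebra_def by blast
  have AB: "monounary_algebra A" "carrier A \<subseteq> carrier B"
    "\<And>x. x \<in> carrier A \<Longrightarrow> oper A x = oper B x"
    using A unfolding subalgebra_def by auto
  have inj: "inj_on h (carrier A)"
    using assms(3) AB(2) by (rule inj_on_subset)
  have "oper (image_algebra h A) (h x) = oper (image_algebra h B) (h x)" if "x \<in> carrier A" for x
    using that AB image_algebra_oper[OF inj] image_algebra_oper[OF assms(3)] by auto
  then have "subalgebra (image_algebra h A) (image_algebra h B)"
    using AB image_algebra(1)[OF AB(1) inj] unfolding subalgebra_def by auto
  moreover have "generates (image_algebra h B) (insert (h b) (carrier (image_algebra h A)))"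
    using generates_image[OF assms(2,3) b(2)] by simp
  ultimately show ?thesis
    using b(1) unfolding large_subalgebra_def by auto
qed

lemma large_subalgebra_embedding:
  includes cardinal_syntax
  fixes f :: "'u \<Rightarrow> 'v"
  assumes "large_subalgebra A B" "monounary_algebra B" "inj_on f (carrier A)"
    "infinite (UNIV :: 'v set)"
  shows "\<exists>g :: 'u \<Rightarrow> 'v. inj_on g (carrier B)"
proof -
  from assms(1) obtain b where A: "subalgebra A B" and
    b: "b \<in> carrier B" "generates B (insert b (carrier A))"
    unfolding large_subalgebra_def by blast
  let ?O = "range (\<lambda>k. (oper B ^^ k) b)"
  have O: "(oper B ^^ k) b \<in> carrier B" for k
    using b(1) assms(2) by (induction k) (auto simp: monounary_algebra_def)
  have cl: "oper B x \<in> carrier A \<union> ?O" if "x \<in> carrier A \<union> ?O" for x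
  proof -
    have "oper B ((oper B ^^ k) b) \<in> ?O" for k
      by (rule image_eqI[where x = "Suc k"]) auto
    moreover have "oper B x \<in> carrier A" if "x \<in> carrier A"
      using that A unfolding subalgebra_def monounary_algebra_def by fastforce
    ultimately show ?thesis using that by blast
  qed
  have "carrier A \<union> ?O \<subseteq> carrier B"
    using O A unfolding subalgebra_def by blast
  moreover have "b \<in> ?O"
    by (rule image_eqI[where x = 0]) auto
  ultimately have "generated B (insert b (carrier A)) \<subseteq> carrier A \<union> ?O"
    using cl unfolding generated_def by (intro hull_minimal) blast+
  then have sub: "carrier B \<subseteq> carrier A \<union> ?O"
    using b(2) unfolding generates_def by simp
  have "|carrier A| \<le>o |UNIV :: 'v set|"
    using assms(3) card_of_ordLeq by blast
  moreover have "|?O| \<le>o |UNIV :: 'v set|"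
    using card_of_image assms(4) infinite_iff_card_of_nat ordLeq_transitive by metis
  ultimately have "|carrier A \<union> ?O| \<le>o |UNIV :: 'v set|"
    using assms(4) card_of_Un_ordLeq_infinite_Field[OF _ _ _ card_of_Card_order]
    by (metis Field_card_of)
  then have "|carrier B| \<le>o |UNIV :: 'v set|"
    using card_of_mono1[OF sub] ordLeq_transitive by blast
  then show ?thesis
    using card_of_ordLeq[of "carrier B" "UNIV :: 'v set"] by auto
qed

lemma network_path_transfer:
  fixes A B :: "'u monounary" and A' B' :: "'v monounary"
  assumes "network_path A es B" "infinite (UNIV :: 'v set)"
    "monounary_algebra A" "monounary_algebra B" "monounary_algebra A'" "monounary_algebra B'"
    "isomorphic A A'" "isomorphic B B'"
  shows "\<exists>es'. network_path A' es' B' \<and> blue_length es' = blue_length es"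
  using assms
proof (induction A es B arbitrary: A' rule: network_path.induct)
  case (1 X Y)
  then have "isomorphic A' B'"
    using isomorphic_sym isomorphic_trans by (metis network_path.simps(1))
  then have "network_path A' [(Red, B')] B'" "blue_length [(Red, B')] = 0"
    using 1 by (auto simp: network_edge_def blue_length_def)
  moreover have "blue_length [] = 0"
    by (simp add: blue_length_def)
  ultimately show ?case by metis
next
  case (2 X c Z es Y)
  have e: "network_edge c X Z" and p: "network_path Z es Y"
    using "2.prems" by auto
  have Z: "monounary_algebra Z"
    using e unfolding network_edge_def by simp
  show ?case
  proof (cases c)
    case Red
    then have "isomorphic Z A'"
      using e "2.prems" isomorphic_sym isomorphic_trans
      unfolding network_edge_def by (metis colour.case(1))
    with "2.IH"[OF p _ Z] "2.prems" Red show ?thesis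
      by (auto simp: blue_length_def)
  next
    case Blue
    obtain f where f: "bij_betw f (carrier X) (carrier A')"
      using "2.prems" unfolding isomorphic_def by blast
    then have f_inj: "inj_on f (carrier X)" by (simp add: bij_betw_def)
    have "\<exists>h :: 'u \<Rightarrow> 'v. inj_on h (carrier X) \<and> inj_on h (carrier Z) \<and>
        (large_subalgebra (image_algebra h X) (image_algebra h Z) \<or>
         large_subalgebra (image_algebra h Z) (image_algebra h X))"
    proof (cases "large_subalgebra X Z")
      case True
      obtain g :: "'u \<Rightarrow> 'v" where "inj_on g (carrier Z)"
        using large_subalgebra_embedding[OF True Z f_inj] "2.prems" by blast
      moreover have "carrier X \<subseteq> carrier Z"
        using True unfolding large_subalgebra_def subalgebra_def by simp
      ultimately show ?thesis
        using large_subalgebra_image[OF True Z] inj_on_subset by blast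
    next
      case False
      then have l: "large_subalgebra Z X"
        using e Blue unfolding network_edge_def by simp
      then have "carrier Z \<subseteq> carrier X"
        unfolding large_subalgebra_def subalgebra_def by simp
      then show ?thesis
        using large_subalgebra_image[OF l _ f_inj] f_inj inj_on_subset "2.prems" by blast
    qed
    then obtain h :: "'u \<Rightarrow> 'v" where h: "inj_on h (carrier X)" "inj_on h (carrier Z)"
      "large_subalgebra (image_algebra h X) (image_algebra h Z) \<or>
       large_subalgebra (image_algebra h Z) (image_algebra h X)"
      by blast
    have X: "monounary_algebra X" using "2.prems" by simp
    have iZ: "monounary_algebra (image_algebra h Z)" "isomorphic Z (image_algebra h Z)"
      using image_algebra[OF Z h(2)] .
    obtain es' where es': "network_path (image_algebra h Z) es' B'"
      "blue_length es' = blue_length es"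
      using "2.IH"[OF p _ Z _ iZ(1) _ iZ(2)] "2.prems" by blast
    have "isomorphic A' (image_algebra h X)"
      using image_algebra(2)[OF X h(1)] isomorphic_sym[OF X] isomorphic_trans "2.prems" by blast
    then have "network_path A' ((Red, image_algebra h X) # (Blue, image_algebra h Z) # es') B'"
      using es'(1) iZ(1) h(3) image_algebra(1)[OF X h(1)] "2.prems"
      by (simp add: network_edge_def)
    then show ?thesis
      using es'(2) Blue
      by (intro exI[of _ "(Red, image_algebra h X) # (Blue, image_algebra h Z) # es'"])
         (auto simp: blue_length_def)
  qed
qed

lemma generator_distance_universe:
  fixes A B :: "'u monounary" and A' B' :: "'v monounary"
  assumes "infinite (UNIV :: 'u set)" "infinite (UNIV :: 'v set)"
    "monounary_algebra A" "monounary_algebra B" "monounary_algebra A'" "monounary_algebra B'"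
    "isomorphic A A'" "isomorphic B B'"
  shows "generator_distance A B = generator_distance A' B'"
proof (rule antisym)
  show "generator_distance A' B' \<le> generator_distance A B"
    unfolding generator_distance_def
    using network_path_transfer[OF _ assms(2,3,4,5,6,7,8)]
    by (intro INF_mono) (metis mem_Collect_eq order_refl)
  show "generator_distance A B \<le> generator_distance A' B'"
    unfolding generator_distance_def
    using network_path_transfer[OF _ assms(1,5,6,3,4)
        isomorphic_sym[OF assms(3,7)] isomorphic_sym[OF assms(4,8)]]
    by (intro INF_mono) (metis mem_Collect_eq order_refl)
qed

end

theory Submission
  imports Defs "HOL-Number_Theory.Cong"
begin

text \<open>
  The lower bound counts generators separately for each core type.  All elements of the orbit of a
  generator have the same core type, so adding or removing one generator changes the rank of the
  elements of only one type, and that by at most one.  A path between connected algebras of different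
  types must bring the rank of the first type down from \<open>d(A)\<close> to \<open>0\<close> and that of the second up from
  \<open>0\<close> to \<open>d(B)\<close>.  For the upper bounds, \<open>d(A) - 1\<close> blue edges lead from \<open>A\<close> to a one-generated
  subalgebra.  Of two one-generated algebras with the same core, the one with the shorter tail is a
  large subalgebra of the other; in general both are large in their disjoint union.
\<close>

section \<open>Generated subalgebras\<close>

text \<open>The iterate form of the hull in \<open>generated\<close>. It mentions the operation
  only, so it can be compared between an algebra and its subalgebras.\<close>

definition forward_closure :: "('a \<Rightarrow> 'a) \<Rightarrow> 'a set \<Rightarrow> 'a set" where
  "forward_closure f S = (\<Union>k. (f ^^ k) ` S)"

lemma forward_closure_iff: "x \<in> forward_closure f S \<longleftrightarrow> (\<exists>s\<in>S. \<exists>k. x = (f ^^ k) s)"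
  unfolding forward_closure_def by auto

lemma funpow_in_forward_closure: "s \<in> S \<Longrightarrow> (f ^^ k) s \<in> forward_closure f S"
  by (auto simp: forward_closure_iff)

lemma subset_forward_closure: "S \<subseteq> forward_closure f S"
  using funpow_in_forward_closure[where k = 0] by fastforce

lemma forward_closure_closed: "f ` forward_closure f S \<subseteq> forward_closure f S"
  by (force simp: forward_closure_iff simp flip: funpow.simps(2) comp_apply[of f])

lemma funpow_closed: "f ` T \<subseteq> T \<Longrightarrow> x \<in> T \<Longrightarrow> (f ^^ k) x \<in> T"
  by (induction k) auto

lemma forward_closure_minimal: "f ` T \<subseteq> T \<Longrightarrow> S \<subseteq> T \<Longrightarrow> forward_closure f S \<subseteq> T"
  by (auto simp: forward_closure_iff intro!: funpow_closed)

lemma forward_closure_insert: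
  "forward_closure f (insert x S) = forward_closure f {x} \<union> forward_closure f S"
  by (auto simp: forward_closure_iff)

lemma countable_forward_closure: "countable S \<Longrightarrow> countable (forward_closure f S)"
  unfolding forward_closure_def by auto

lemma monounary_closed: "monounary_algebra A \<Longrightarrow> oper A ` carrier A \<subseteq> carrier A"
  by (simp add: monounary_algebra_def)

lemma generated_eq:
  assumes "monounary_algebra A" "S \<subseteq> carrier A"
  shows "generated A S = forward_closure (oper A) S"
  unfolding generated_def
proof (rule hull_unique)
  show "forward_closure (oper A) S \<subseteq> carrier A \<and>
      oper A ` forward_closure (oper A) S \<subseteq> forward_closure (oper A) S"
    using forward_closure_minimal[OF monounary_closed[OF assms(1)] assms(2)]
      forward_closure_closed[of "oper A" S] by (rule conjI)
qed (simp_all add: subset_forward_closure forward_closure_minimal)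

lemma generates_iff:
  assumes "monounary_algebra A"
  shows "generates A S \<longleftrightarrow> S \<subseteq> carrier A \<and> carrier A \<subseteq> forward_closure (oper A) S"
  unfolding generates_def
  using generated_eq[OF assms] forward_closure_minimal[OF monounary_closed[OF assms]] by auto

lemma funpow_subalgebra:
  assumes "subalgebra X Y" "x \<in> carrier X"
  shows "(oper Y ^^ k) x = (oper X ^^ k) x" "(oper X ^^ k) x \<in> carrier X"
proof -
  have X: "monounary_algebra X" "\<And>x. x \<in> carrier X \<Longrightarrow> oper X x = oper Y x"
    using assms unfolding subalgebra_def by auto
  show mem: "(oper X ^^ k) x \<in> carrier X" for k
    by (rule funpow_closed[OF monounary_closed[OF X(1)] assms(2)])
  show "(oper Y ^^ k) x = (oper X ^^ k) x"
    using X(2) mem by (induction k) auto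
qed

lemma forward_closure_subalgebra:
  "subalgebra X Y \<Longrightarrow> S \<subseteq> carrier X \<Longrightarrow> forward_closure (oper Y) S = forward_closure (oper X) S"
  unfolding forward_closure_def by (auto simp: funpow_subalgebra(1) subset_iff image_iff)

text \<open>The carrier of \<open>X\<close> is already closed under the operation of
  \<open>Y\<close>, so the extra generator contributes just its own orbit.\<close>

lemma large_subalgebra_carrier:
  assumes "large_subalgebra X Y" "monounary_algebra Y"
  obtains b where "b \<in> carrier Y" "carrier Y = carrier X \<union> forward_closure (oper Y) {b}"
proof -
  obtain b where b: "b \<in> carrier Y" "generates Y (insert b (carrier X))" and s: "subalgebra X Y"
    using assms unfolding large_subalgebra_def by blast
  have "forward_closure (oper Y) (carrier X) = carrier X"
    using forward_closure_subalgebra[OF s] s forward_closure_minimal[OF monounary_closed]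
      subset_forward_closure unfolding subalgebra_def by (metis order_refl subset_antisym)
  then have "carrier Y \<subseteq> carrier X \<union> forward_closure (oper Y) {b}"
    using b(2) forward_closure_insert[of "oper Y" b "carrier X"]
    unfolding generates_iff[OF assms(2)] by auto
  moreover have "forward_closure (oper Y) {b} \<subseteq> carrier Y"
    using b(1) by (intro forward_closure_minimal monounary_closed assms) auto
  ultimately show ?thesis
    using that b(1) s unfolding subalgebra_def by blast
qed

lemma large_subalgebraI:
  assumes "subalgebra X Y" "monounary_algebra Y" "b \<in> carrier Y"
    "carrier Y \<subseteq> carrier X \<union> forward_closure (oper Y) {b}"
  shows "large_subalgebra X Y"
proof -
  have "carrier Y \<subseteq> forward_closure (oper Y) (insert b (carrier X))"
    using assms(4) subset_forward_closure[of "carrier X" "oper Y"]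
      forward_closure_insert[of "oper Y" b "carrier X"] by blast
  then show ?thesis
    using assms generates_iff[OF assms(2)]
    unfolding large_subalgebra_def subalgebra_def by blast
qed

section \<open>One-generated subalgebras\<close>

definition cyclic :: "'a monounary \<Rightarrow> 'a \<Rightarrow> 'a monounary" where
  "cyclic A x = A\<lparr>carrier := forward_closure (oper A) {x}\<rparr>"

lemma cyclic_simps [simp]:
  "carrier (cyclic A x) = forward_closure (oper A) {x}" "oper (cyclic A x) = oper A"
  by (simp_all add: cyclic_def)

lemma monounary_algebra_restrict:
  "S \<noteq> {} \<Longrightarrow> monounary_algebra (A\<lparr>carrier := forward_closure (oper A) S\<rparr>)"
  using subset_forward_closure[of S "oper A"] forward_closure_closed[of "oper A" S]
  unfolding monounary_algebra_def by auto

lemma monounary_algebra_cyclic [simp]: "monounary_algebra (cyclic A x)"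
  unfolding cyclic_def by (rule monounary_algebra_restrict) simp

lemma subalgebra_cyclic:
  assumes "monounary_algebra A" "x \<in> carrier A"
  shows "subalgebra (cyclic A x) A"
  using forward_closure_minimal[OF monounary_closed[OF assms(1)], of "{x}"] assms(2)
  unfolding subalgebra_def by simp

text \<open>A one-generated algebra is determined by the equations between the iterates of its
  generator: matching i-th iterates is then well defined and injective.\<close>

lemma isomorphic_cyclic:
  assumes "\<And>i j. (oper A ^^ i) x = (oper A ^^ j) x \<longleftrightarrow> (oper B ^^ i) y = (oper B ^^ j) y"
  shows "isomorphic (cyclic A x) (cyclic B y)"
proof -
  \<comment> \<open>The choice of exponent is immaterial: by the assumption, all exponents reaching
    \<open>z\<close> from \<open>x\<close> give the same value from \<open>y\<close>.\<close>
  define h where "h z = (oper B ^^ (SOME i. (oper A ^^ i) x = z)) y" for z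
  have h: "h ((oper A ^^ i) x) = (oper B ^^ i) y" for i
  proof -
    have "(oper A ^^ (SOME j. (oper A ^^ j) x = (oper A ^^ i) x)) x = (oper A ^^ i) x"
      by (rule someI) (rule refl)
    then show ?thesis
      unfolding h_def using assms by simp
  qed
  have "bij_betw h (forward_closure (oper A) {x}) (forward_closure (oper B) {y})"
  proof (intro bij_betwI')
    fix z assume "z \<in> forward_closure (oper B) {y}"
    then obtain i where "z = h ((oper A ^^ i) x)" by (auto simp: forward_closure_iff h)
    then show "\<exists>w\<in>forward_closure (oper A) {x}. z = h w"
      using funpow_in_forward_closure[of x "{x}"] by blast
  qed (use assms in \<open>auto simp: forward_closure_iff h\<close>)
  moreover have "h (oper A z) = oper B (h z)" if "z \<in> forward_closure (oper A) {x}" for z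
  proof -
    from that obtain i where "z = (oper A ^^ i) x" by (auto simp: forward_closure_iff)
    then show ?thesis using h[of i] h[of "Suc i"] by simp
  qed
  ultimately show ?thesis
    unfolding isomorphic_def by auto
qed

section \<open>The core type of an element\<close>

text \<open>The multiples of the length of the cycle that the orbit of \<open>x\<close> runs into,
  and \<open>{0}\<close> if the orbit is infinite; so this set encodes the core below \<open>x\<close>.\<close>

definition return_times :: "('a \<Rightarrow> 'a) \<Rightarrow> 'a \<Rightarrow> nat set" where
  "return_times f x = {n. \<exists>k. (f ^^ (k + n)) x = (f ^^ k) x}"

text \<open>A witness \<open>k\<close> for \<open>x\<close> is also one for \<open>f x\<close>; a
  witness \<open>k\<close> for \<open>f x\<close> makes \<open>k + 1\<close> one for
  \<open>x\<close>.\<close>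

lemma return_times_step: "return_times f (f x) = return_times f x"
proof -
  have "(\<exists>k. (f ^^ (k + n)) (f x) = (f ^^ k) (f x)) \<longleftrightarrow> (\<exists>k. (f ^^ (k + n)) x = (f ^^ k) x)" for n
    by (metis add_Suc funpow.simps(2) comp_apply funpow_swap1)
  then show ?thesis unfolding return_times_def by simp
qed

lemma return_times_funpow [simp]: "return_times f ((f ^^ k) x) = return_times f x"
  by (induction k) (simp_all add: return_times_step)

lemma return_times_subalgebra:
  "subalgebra X Y \<Longrightarrow> x \<in> carrier X \<Longrightarrow> return_times (oper Y) x = return_times (oper X) x"
  unfolding return_times_def by (simp add: funpow_subalgebra(1))

text \<open>Any two orbits meet, and return times are constant along an orbit.\<close>

lemma return_times_connected:
  "connected_algebra A \<Longrightarrow> x \<in> carrier A \<Longrightarrow> y \<in> carrier A \<Longrightarrow>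
    return_times (oper A) x = return_times (oper A) y"
  unfolding connected_algebra_def by (metis return_times_funpow)

lemma funpow_hom:
  assumes "monounary_algebra X" "\<And>x. x \<in> carrier X \<Longrightarrow> h (oper X x) = oper Y (h x)" "x \<in> carrier X"
  shows "h ((oper X ^^ k) x) = (oper Y ^^ k) (h x)"
  using assms(2) funpow_closed[OF monounary_closed[OF assms(1)] assms(3)]
  by (induction k) simp_all

lemma return_times_iso:
  assumes "monounary_algebra X" "\<And>x. x \<in> carrier X \<Longrightarrow> h (oper X x) = oper Y (h x)"
    "inj_on h (carrier X)" "x \<in> carrier X"
  shows "return_times (oper Y) (h x) = return_times (oper X) x"
proof -
  have "(oper X ^^ k) x \<in> carrier X" for k
    by (rule funpow_closed[OF monounary_closed[OF assms(1)] assms(4)])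
  then show ?thesis
    unfolding return_times_def
    using assms(3) by (simp add: inj_on_eq_iff flip: funpow_hom[where h = h and Y = Y, OF assms(1,2,4)])
qed

text \<open>The orbit of \<open>x\<close> is a tail of length \<open>s\<close> running into a cycle of length \<open>n\<close>; since congruence
  modulo \<open>0\<close> is equality, \<open>n = 0\<close> stands for an infinite orbit.\<close>

definition rho_shaped :: "('a \<Rightarrow> 'a) \<Rightarrow> 'a \<Rightarrow> nat \<Rightarrow> nat \<Rightarrow> bool" where
  "rho_shaped f x s n \<longleftrightarrow>
     (\<forall>i j. (f ^^ i) x = (f ^^ j) x \<longleftrightarrow> i = j \<or> s \<le> i \<and> s \<le> j \<and> [i = j] (mod n))"

lemma rho_shaped_exists:
  fixes f :: "'a \<Rightarrow> 'a"
  obtains s n where "rho_shaped f x s n"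
proof (cases "\<exists>i j. i < j \<and> (f ^^ i) x = (f ^^ j) x")
  case False
  then have "(f ^^ i) x = (f ^^ j) x \<longleftrightarrow> i = j" for i j
    by (metis linorder_neqE_nat)
  then show ?thesis using that[of 0 0] by (simp add: rho_shaped_def)
next
  case True
  \<comment> \<open>The first exponent whose value recurs, that is, the length of the tail;
    \<open>n\<close> below is the least period of the point \<open>y\<close> reached there.\<close>
  define s where "s = (LEAST i. \<exists>j>i. (f ^^ i) x = (f ^^ j) x)"
  have s: "\<exists>j>s. (f ^^ s) x = (f ^^ j) x"
    unfolding s_def by (rule LeastI_ex) (use True in blast)
  have s_le: "s \<le> i" if "i < j" "(f ^^ i) x = (f ^^ j) x" for i j
    unfolding s_def by (rule Least_le) (use that in blast)
  define y where "y = (f ^^ s) x"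
  have shift: "(f ^^ i) x = (f ^^ (i - s)) y" if "s \<le> i" for i
    using that unfolding y_def by (simp flip: funpow_add comp_apply[of "f ^^ (i - s)"])
  define n where "n = (LEAST j. 0 < j \<and> (f ^^ j) y = y)"
  obtain j where "s < j" "(f ^^ s) x = (f ^^ j) x" using s by blast
  then have ex: "0 < j - s \<and> (f ^^ (j - s)) y = y"
    using shift[of j] by (simp add: y_def)
  have n: "0 < n" "(f ^^ n) y = y"
    using LeastI[of "\<lambda>j. 0 < j \<and> (f ^^ j) y = y", OF ex] unfolding n_def by auto
  have n_le: "n \<le> j" if "0 < j" "(f ^^ j) y = y" for j
    unfolding n_def by (rule Least_le) (use that in blast)
  \<comment> \<open>Applying \<open>f\<close> another \<open>n - q\<close> times turns the
    right-hand side into \<open>y\<close>, so \<open>n - q + p\<close>, positive and below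
    \<open>n\<close>, would be a period.\<close>
  have no: False if "p < q" "q < n" "(f ^^ p) y = (f ^^ q) y" for p q
  proof -
    have "(f ^^ (n - q + p)) y = (f ^^ (n - q + q)) y"
      using that(3) by (simp only: funpow_add comp_apply)
    then have "(f ^^ (n - q + p)) y = y"
      using that(2) n by simp
    then show False using n_le[of "n - q + p"] that by simp
  qed
  have per: "(f ^^ i) y = (f ^^ j) y \<longleftrightarrow> i mod n = j mod n" for i j
    using funpow_mod_eq[OF n(2), of i] funpow_mod_eq[OF n(2), of j] no n(1)
    by (metis linorder_neqE_nat mod_less_divisor)
  have eq: "(f ^^ i) x = (f ^^ j) x \<longleftrightarrow> [i = j] (mod n)" if "s \<le> i" "s \<le> j" for i j
  proof -
    have "[i = j] (mod n) \<longleftrightarrow> [i - s + s = j - s + s] (mod n)"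
      using that by simp
    also have "\<dots> \<longleftrightarrow> [i - s = j - s] (mod n)"
      by (rule cong_add_rcancel_nat)
    finally show ?thesis
      using shift that per by (simp add: cong_def)
  qed
  have "s \<le> i" "s \<le> j" if "(f ^^ i) x = (f ^^ j) x" "i \<noteq> j" for i j
    using that s_le by (metis linorder_neqE_nat order.trans less_imp_le)+
  then show ?thesis
    using that eq unfolding rho_shaped_def by metis
qed

lemma return_times_rho_shaped:
  assumes "rho_shaped f x s n"
  shows "return_times f x = {m. n dvd m}"
proof -
  have "[k + m = k] (mod n) \<longleftrightarrow> n dvd m" for k m
    using cong_add_lcancel_nat[of k m 0 n] by (simp add: cong_0_iff)
  \<comment> \<open>\<open>k + m = k\<close> forces \<open>m = 0\<close>, which \<open>n\<close>
    divides; conversely \<open>k = s\<close> is a witness for every multiple of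
    \<open>n\<close>.\<close>
  moreover have "(\<exists>k. k + m = k \<or> s \<le> k + m \<and> s \<le> k \<and> n dvd m) \<longleftrightarrow> n dvd m" for m
    by (auto intro: exI[of _ s])
  ultimately show ?thesis
    using assms unfolding return_times_def rho_shaped_def by simp
qed

text \<open>A natural number, including 0, is determined by its multiples. Hence equal return times
  yield one common period, while the tails may differ.\<close>

lemma rho_shaped_same_cycle:
  assumes "return_times f x = return_times g y"
  obtains s t n where
    "rho_shaped f x s n"
    "rho_shaped g y t n"
proof -
  obtain s n where f: "rho_shaped f x s n"
    using rho_shaped_exists by metis
  obtain t m where g: "rho_shaped g y t m"
    using rho_shaped_exists by metis
  have "{k. n dvd k} = {k. m dvd k}"
    using return_times_rho_shaped[OF f] return_times_rho_shaped[OF g] assms by simp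
  then have "n = m"
    by (metis dvd_antisym dvd_refl mem_Collect_eq)
  then show ?thesis using that f g by blast
qed

section \<open>Standard cores and their copies inside an algebra\<close>

lemma C_omega_eq_cyclic: "C_omega = cyclic C_omega 0"
proof -
  have "(Suc ^^ k) 0 = k" for k by (induction k) auto
  then show ?thesis
    unfolding cyclic_def C_omega_def by (auto simp: forward_closure_iff)
qed

lemma funpow_C_cycle: "n \<noteq> 0 \<Longrightarrow> (oper (C_cycle n) ^^ k) 0 = k mod n"
  by (induction k) (auto simp: C_cycle_def mod_Suc_eq)

lemma C_cycle_eq_cyclic:
  assumes "n \<noteq> 0" shows "C_cycle n = cyclic (C_cycle n) 0"
proof -
  have "{0..<n} = forward_closure (oper (C_cycle n)) {0}"
    using assms by (auto simp: forward_closure_iff funpow_C_cycle) (metis mod_less)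
  then show ?thesis
    unfolding cyclic_def by (simp add: C_cycle_def)
qed

text \<open>The assumption describes an orbit without tail; for \<open>n = 0\<close> the congruence
  is equality, so the iterates are distinct.\<close>

lemma isomorphic_standard_core:
  fixes A :: "'a monounary"
  assumes "\<And>i j. (oper A ^^ i) x = (oper A ^^ j) x \<longleftrightarrow> [i = j] (mod n)"
  shows "isomorphic (cyclic A x) (if n = 0 then C_omega else C_cycle n)"
proof (cases "n = 0")
  case True
  have "(oper C_omega ^^ k) 0 = k" for k by (induction k) (auto simp: C_omega_def)
  then have "isomorphic (cyclic A x) (cyclic C_omega 0)"
    using assms True by (intro isomorphic_cyclic) simp
  then show ?thesis using True C_omega_eq_cyclic by simp
next
  case False
  then have "isomorphic (cyclic A x) (cyclic (C_cycle n) 0)"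
    using assms by (intro isomorphic_cyclic) (simp add: funpow_C_cycle cong_def)
  then show ?thesis using False C_cycle_eq_cyclic by simp
qed

text \<open>After \<open>s\<close> steps the tail is used up, and only congruence of exponents
  decides whether two iterates agree.\<close>

lemma cyclic_core:
  assumes "monounary_algebra A" "x \<in> carrier A"
    "rho_shaped (oper A) x s n"
  shows "is_core (cyclic A ((oper A ^^ s) x)) A"
    "isomorphic (cyclic A ((oper A ^^ s) x)) (if n = 0 then C_omega else C_cycle n)"
proof -
  have "(oper A ^^ i) ((oper A ^^ s) x) = (oper A ^^ (i + s)) x" for i
    by (simp add: funpow_add)
  then have "(oper A ^^ i) ((oper A ^^ s) x) = (oper A ^^ j) ((oper A ^^ s) x) \<longleftrightarrow> [i = j] (mod n)"
    for i j
    using assms(3) cong_add_rcancel_nat unfolding rho_shaped_def by auto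
  then show iso: "isomorphic (cyclic A ((oper A ^^ s) x)) (if n = 0 then C_omega else C_cycle n)"
    by (rule isomorphic_standard_core)
  have "(oper A ^^ s) x \<in> carrier A"
    by (rule funpow_closed[OF monounary_closed[OF assms(1)] assms(2)])
  then show "is_core (cyclic A ((oper A ^^ s) x)) A"
    using iso subalgebra_cyclic[OF assms(1)] unfolding is_core_def by (auto split: if_splits)
qed

text \<open>With a common period both cores are copies of the same standard algebra.\<close>

lemma isomorphic_cores_if_return_times:
  assumes "monounary_algebra A" "monounary_algebra B" "a \<in> carrier A" "b \<in> carrier B"
    "return_times (oper A) a = return_times (oper B) b"
  shows "isomorphic_cores A B"
proof -
  obtain s t n where
    A: "rho_shaped (oper A) a s n"
    and B: "rho_shaped (oper B) b t n"
    using rho_shaped_same_cycle[OF assms(5)] by metis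
  show ?thesis
    using cyclic_core[OF assms(1,3) A] cyclic_core[OF assms(2,4) B]
      isomorphic_sym[OF monounary_algebra_cyclic] isomorphic_trans
    unfolding isomorphic_cores_def by metis
qed

text \<open>By connectedness the return times may be read off at an element of the core, where the
  isomorphism carries them over.\<close>

lemma return_times_if_isomorphic_cores:
  assumes "isomorphic_cores A B" "connected_algebra A" "connected_algebra B"
    "a \<in> carrier A" "b \<in> carrier B"
  shows "return_times (oper A) a = return_times (oper B) b"
proof -
  obtain C D where C: "subalgebra C A" and D: "subalgebra D B" and iso: "isomorphic C D"
    using assms(1) unfolding isomorphic_cores_def is_core_def by blast
  obtain h where h: "bij_betw h (carrier C) (carrier D)"
    "\<And>x. x \<in> carrier C \<Longrightarrow> h (oper C x) = oper D (h x)"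
    using iso unfolding isomorphic_def by blast
  have "monounary_algebra C" using C unfolding subalgebra_def by simp
  then obtain c where c: "c \<in> carrier C" unfolding monounary_algebra_def by blast
  have hc: "h c \<in> carrier D" using h(1) c by (auto simp: bij_betw_def)
  have "return_times (oper A) a = return_times (oper A) c"
    using return_times_connected[OF assms(2,4)] c C unfolding subalgebra_def by blast
  also have "\<dots> = return_times (oper C) c"
    by (rule return_times_subalgebra[OF C c])
  also have "\<dots> = return_times (oper D) (h c)"
    using return_times_iso[where h = h and Y = D, OF \<open>monounary_algebra C\<close> h(2) _ c] h(1)
    by (simp add: bij_betw_def)
  also have "\<dots> = return_times (oper B) (h c)"
    by (rule return_times_subalgebra[OF D hc, symmetric])
  also have "\<dots> = return_times (oper B) b"
    using return_times_connected[OF assms(3) _ assms(5)] hc D unfolding subalgebra_def by blast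
  finally show ?thesis .
qed

section \<open>Ranks of the parts of a given core type\<close>

text \<open>The union of the connected components of core type \<open>R\<close>.\<close>

definition part :: "nat set \<Rightarrow> 'a monounary \<Rightarrow> 'a set" where
  "part R X = {x \<in> carrier X. return_times (oper X) x = R}"

text \<open>Phrased with sets rather than through \<open>min_generators\<close>, since a part may be
  empty and hence no algebra. The empty part gets rank 0, and a part that is not finitely generated
  gets \<infinity>.\<close>

definition part_rank :: "nat set \<Rightarrow> 'a monounary \<Rightarrow> enat" where
  "part_rank R X =
     (INF S\<in>{S. finite S \<and> S \<subseteq> part R X \<and> part R X \<subseteq> forward_closure (oper X) S}. enat (card S))"

lemma part_rank_le:
  "finite S \<Longrightarrow> S \<subseteq> part R X \<Longrightarrow> part R X \<subseteq> forward_closure (oper X) S \<Longrightarrow>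
    part_rank R X \<le> enat (card S)"
  unfolding part_rank_def by (rule INF_lower) simp

text \<open>\<open>enat\<close> is well-ordered, so only an empty family can fail to attain its
  infimum, and that infimum would be \<infinity>.\<close>

lemma INF_enat_attained:
  assumes k: "k = (INF x\<in>M. enat (f x))" "k \<noteq> \<infinity>"
  obtains x where "x \<in> M" "k = enat (f x)"
proof -
  obtain x where "x \<in> M"
    using k by (metis Inf_empty ex_in_conv image_empty top_enat_def)
  then have "k \<in> (\<lambda>x. enat (f x)) ` M"
    unfolding k(1) by (intro wellorder_InfI[of "enat (f x)"] imageI)
  then show ?thesis using that by (elim imageE)
qed

lemma part_rank_attained:
  assumes "part_rank R X \<noteq> \<infinity>"
  obtains S where "finite S" "S \<subseteq> part R X" "part R X \<subseteq> forward_closure (oper X) S"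
    "part_rank R X = enat (card S)"
  by (rule INF_enat_attained[OF part_rank_def assms]) (use that in blast)

lemma part_rank_empty: "part R X = {} \<Longrightarrow> part_rank R X = 0"
  using part_rank_le[of "{}" R X] by (simp add: zero_enat_def[symmetric])

lemma part_rank_carrier:
  assumes "monounary_algebra X" "part R X = carrier X"
  shows "part_rank R X = min_generators X"
  unfolding part_rank_def min_generators_def generates_iff[OF assms(1)] assms(2) by simp

lemma part_connected:
  assumes "connected_algebra X" "x \<in> carrier X"
  shows "part R X = (if R = return_times (oper X) x then carrier X else {})"
  using return_times_connected[OF assms(1) _ assms(2)] unfolding part_def by auto

lemma part_subalgebra: "subalgebra X Y \<Longrightarrow> part R X = part R Y \<inter> carrier X"
  using return_times_subalgebra[of X Y] unfolding part_def subalgebra_def by auto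

section \<open>Change of the ranks along isomorphisms, edges and paths\<close>

lemma part_rank_iso_le:
  assumes "monounary_algebra X" "isomorphic X Y"
  shows "part_rank R Y \<le> part_rank R X"
proof (cases "part_rank R X = \<infinity>")
  case False
  obtain h where h: "bij_betw h (carrier X) (carrier Y)"
    "\<And>x. x \<in> carrier X \<Longrightarrow> h (oper X x) = oper Y (h x)"
    using assms(2) unfolding isomorphic_def by blast
  obtain S where S: "finite S" "S \<subseteq> part R X" "part R X \<subseteq> forward_closure (oper X) S"
    "part_rank R X = enat (card S)"
    using part_rank_attained[OF False] by blast
  have part: "part R Y = h ` part R X"
  proof -
    have "return_times (oper Y) (h x) = return_times (oper X) x" if "x \<in> carrier X" for x
      using return_times_iso[where h = h and Y = Y, OF assms(1) h(2)] h(1) that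
      unfolding bij_betw_def by blast
    moreover have "carrier Y = h ` carrier X" using h(1) by (simp add: bij_betw_def)
    ultimately show ?thesis unfolding part_def by force
  qed
  have "h ((oper X ^^ k) x) = (oper Y ^^ k) (h x)" if "x \<in> S" for x k
    using funpow_hom[where h = h and Y = Y, OF assms(1) h(2)] S(2) that unfolding part_def by blast
  then have "h ` forward_closure (oper X) S \<subseteq> forward_closure (oper Y) (h ` S)"
    by (auto simp: forward_closure_iff[of _ _ S] intro!: funpow_in_forward_closure)
  then have "part_rank R Y \<le> enat (card (h ` S))"
    using S part by (intro part_rank_le) auto
  also have "\<dots> \<le> enat (card S)" using S(1) by (simp add: card_image_le)
  finally show ?thesis using S(4) by simp
qed simp

lemma part_rank_iso:
  assumes "monounary_algebra X" "monounary_algebra Y" "isomorphic X Y"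
  shows "part_rank R X = part_rank R Y"
  using part_rank_iso_le[OF assms(1,3)] part_rank_iso_le[OF assms(2) isomorphic_sym[OF assms(1,3)]]
  by (rule antisym[rotated])

text \<open>If \<open>b\<close> has type \<open>R\<close>, it is added to the generators. Otherwise
  its whole orbit has another type and the old generators suffice.\<close>

lemma part_rank_insert_le:
  assumes "subalgebra X Y" "b \<in> carrier Y" "carrier Y = carrier X \<union> forward_closure (oper Y) {b}"
  shows "part_rank R Y \<le> part_rank R X + 1"
proof (cases "part_rank R X = \<infinity>")
  case False
  obtain S where S: "finite S" "S \<subseteq> part R X" "part R X \<subseteq> forward_closure (oper X) S"
    "part_rank R X = enat (card S)"
    using part_rank_attained[OF False] by blast
  have sub: "part R X = part R Y \<inter> carrier X" by (rule part_subalgebra[OF assms(1)])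
  have "forward_closure (oper X) S = forward_closure (oper Y) S"
    using forward_closure_subalgebra[OF assms(1), of S] S(2) sub by blast
  then have X: "part R Y \<inter> carrier X \<subseteq> forward_closure (oper Y) S" using S(3) sub by simp
  show ?thesis
  proof (cases "b \<in> part R Y")
    case True
    then have "part R Y \<subseteq> forward_closure (oper Y) (insert b S)"
      using X assms(3) forward_closure_insert[of "oper Y" b S] unfolding part_def by auto
    then have "part_rank R Y \<le> enat (card (insert b S))"
      using True S sub by (intro part_rank_le) auto
    also have "\<dots> \<le> enat (card S + 1)" using S(1) by (simp add: card_insert_if)
    finally show ?thesis using S(4) by (simp add: one_enat_def)
  next
    case False
    then have "part R Y \<inter> forward_closure (oper Y) {b} = {}"
      using assms(2) unfolding part_def by (auto simp: forward_closure_iff)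
    then have "part R Y \<subseteq> forward_closure (oper Y) S"
      using X assms(3) unfolding part_def by blast
    then have "part_rank R Y \<le> enat (card S)"
      using S sub by (intro part_rank_le) auto
    then show ?thesis using S(4) by (metis add_increasing2 dual_order.trans le_cases zero_le)
  qed
qed simp

text \<open>The generators of \<open>Y\<close> outside \<open>X\<close> lie on the orbit of \<open>b\<close>, so within \<open>X\<close> the single point
  where this orbit enters \<open>X\<close> replaces all of them.\<close>

lemma part_rank_remove_le:
  assumes "subalgebra X Y" "carrier Y = carrier X \<union> forward_closure (oper Y) {b}"
  shows "part_rank R X \<le> part_rank R Y + 1"
proof (cases "part_rank R Y = \<infinity>")
  case False
  obtain S where S: "finite S" "S \<subseteq> part R Y" "part R Y \<subseteq> forward_closure (oper Y) S"
    "part_rank R Y = enat (card S)"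
    using part_rank_attained[OF False] by blast
  have sub: "part R X = part R Y \<inter> carrier X" by (rule part_subalgebra[OF assms(1)])
  \<comment> \<open>At most one point: the first entry of the orbit of \<open>b\<close> into
    \<open>X\<close>, kept only if it has type \<open>R\<close>.\<close>
  define E where "E = {c \<in> part R X. \<exists>j. c = (oper Y ^^ j) b \<and> (\<forall>i<j. (oper Y ^^ i) b \<notin> carrier X)}"
  have E: "E \<subseteq> {c}" if "c \<in> E" for c
  proof
    fix d assume "d \<in> E"
    with \<open>c \<in> E\<close> obtain i j where "d = (oper Y ^^ i) b" "c = (oper Y ^^ j) b" "c \<in> carrier X" "d \<in> carrier X"
      "\<forall>k<i. (oper Y ^^ k) b \<notin> carrier X" "\<forall>k<j. (oper Y ^^ k) b \<notin> carrier X"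
      unfolding E_def part_def by blast
    then show "d \<in> {c}" by (metis linorder_neqE_nat singletonI)
  qed
  have finE: "finite E" "card E \<le> 1"
  proof -
    show "finite E" using E by (metis equals0I finite.simps finite_subset)
    show "card E \<le> 1"
      using E by (metis card_mono card.empty equals0I finite.intros is_singletonI is_singleton_altdef zero_le)
  qed
  let ?T = "(S \<inter> carrier X) \<union> E"
  have T: "?T \<subseteq> part R X" using S(2) sub unfolding E_def by blast
  have "x \<in> forward_closure (oper Y) ?T" if x: "x \<in> part R X" for x
  proof -
    have "x \<in> forward_closure (oper Y) S" using x S(3) sub by blast
    then obtain s i where s: "s \<in> S" "x = (oper Y ^^ i) s"
      by (auto simp: forward_closure_iff)
    show ?thesis
    proof (cases "s \<in> carrier X")
      case True
      then show ?thesis using s by (auto intro: funpow_in_forward_closure)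
    next
      case False
      then have "s \<in> forward_closure (oper Y) {b}" using s(1) S(2) assms(2) unfolding part_def by blast
      then obtain l where "s = (oper Y ^^ l) b" by (auto simp: forward_closure_iff)
      then have xl: "x = (oper Y ^^ (i + l)) b" using s(2) by (simp add: funpow_add)
      \<comment> \<open>\<open>x\<close> itself is a point of this orbit inside \<open>X\<close>, so
        a first entry exists and comes no later than \<open>x\<close>.\<close>
      define j where "j = (LEAST j. (oper Y ^^ j) b \<in> carrier X)"
      have xX: "(oper Y ^^ (i + l)) b \<in> carrier X" using x xl sub by auto
      have j: "(oper Y ^^ j) b \<in> carrier X" "j \<le> i + l" "\<forall>i<j. (oper Y ^^ i) b \<notin> carrier X"
        unfolding j_def using LeastI[of "\<lambda>j. (oper Y ^^ j) b \<in> carrier X", OF xX]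
          Least_le[of "\<lambda>j. (oper Y ^^ j) b \<in> carrier X", OF xX] not_less_Least by blast+
      \<comment> \<open>\<open>x\<close> and the entry point lie on one orbit, so the entry point
        has type \<open>R\<close> as well.\<close>
      have "R = return_times (oper Y) ((oper Y ^^ (i + l)) b)"
        using x xl sub unfolding part_def by auto
      then have "(oper Y ^^ j) b \<in> part R Y"
        using j(1) assms(2) unfolding part_def by auto
      then have "(oper Y ^^ j) b \<in> part R X"
        using j(1) sub by blast
      then have "(oper Y ^^ j) b \<in> E" using j unfolding E_def by blast
      moreover have "x = (oper Y ^^ (i + l - j)) ((oper Y ^^ j) b)"
        using xl j(2) by (simp flip: comp_apply[of "_ ^^ _"] funpow_add)
      ultimately show ?thesis by (metis UnCI funpow_in_forward_closure)
    qed
  qed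
  moreover have "forward_closure (oper X) ?T = forward_closure (oper Y) ?T"
    using forward_closure_subalgebra[OF assms(1), of ?T] T sub by blast
  ultimately have "part_rank R X \<le> enat (card ?T)"
    using S(1) finE T by (intro part_rank_le) auto
  also have "card ?T \<le> card (S \<inter> carrier X) + card E" by (rule card_Un_le)
  also have "\<dots> \<le> card S + 1"
    using finE(2) S(1) by (intro add_mono) (auto intro: card_mono)
  finally show ?thesis using S(4) by (simp add: one_enat_def)
qed simp

text \<open>The exceptional \<open>R\<close> is the core type of the added generator. Its orbit
  avoids all other parts, which therefore coincide in \<open>X\<close> and \<open>Y\<close>.\<close>

lemma part_rank_large:
  assumes "large_subalgebra X Y" "monounary_algebra Y"
  obtains R where "\<And>Q. Q \<noteq> R \<Longrightarrow> part_rank Q X = part_rank Q Y"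
    "part_rank R X \<le> part_rank R Y + 1" "part_rank R Y \<le> part_rank R X + 1"
proof -
  obtain b where b: "b \<in> carrier Y" "carrier Y = carrier X \<union> forward_closure (oper Y) {b}"
    using large_subalgebra_carrier[OF assms] by blast
  have sub: "subalgebra X Y" using assms(1) unfolding large_subalgebra_def by simp
  have "part_rank Q X = part_rank Q Y" if "Q \<noteq> return_times (oper Y) b" for Q
  proof -
    have "part Q Y \<inter> forward_closure (oper Y) {b} = {}"
      using that unfolding part_def by (auto simp: forward_closure_iff)
    then have eq: "part Q X = part Q Y"
      using b(2) part_subalgebra[OF sub, of Q] unfolding part_def[of Q Y] by auto
    have "forward_closure (oper X) S = forward_closure (oper Y) S" if "S \<subseteq> part Q Y" for S
      using forward_closure_subalgebra[OF sub, of S] that eq unfolding part_def[of Q X] by blast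
    then show ?thesis
      unfolding part_rank_def eq by (intro INF_cong) auto
  qed
  then show ?thesis
    using that part_rank_remove_le[OF sub b(2)] part_rank_insert_le[OF sub b] by blast
qed

text \<open>\<open>m\<close> bounds the loss of \<open>Q\<close>-rank and \<open>n\<close> the gain
  of \<open>R\<close>-rank. As a blue edge changes the rank of one type only, at most one of them is
  1.\<close>

lemma part_rank_edge:
  assumes "network_edge c X Y" "Q \<noteq> R"
  obtains m n :: nat where "part_rank Q X \<le> part_rank Q Y + m" "part_rank R Y \<le> part_rank R X + n"
    "m + n \<le> (if c = Blue then 1 else 0)"
proof (cases c)
  case Red
  then have "part_rank P X = part_rank P Y" for P
    using assms(1) part_rank_iso[of X Y P] unfolding network_edge_def by simp
  then show ?thesis using that[of 0 0] by (simp add: zero_enat_def[symmetric])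
next
  case Blue
  have XY: "monounary_algebra X" "monounary_algebra Y" "large_subalgebra X Y \<or> large_subalgebra Y X"
    using assms(1) Blue unfolding network_edge_def by auto
  obtain P where P: "\<And>Q. Q \<noteq> P \<Longrightarrow> part_rank Q X = part_rank Q Y"
    "part_rank P X \<le> part_rank P Y + 1" "part_rank P Y \<le> part_rank P X + 1"
    using XY(3)
  proof
    assume "large_subalgebra X Y"
    from part_rank_large[OF this XY(2)] that show ?thesis by metis
  next
    assume "large_subalgebra Y X"
    from part_rank_large[OF this XY(1)] that show ?thesis by metis
  qed
  show ?thesis
  proof (cases "P = Q")
    case True
    then show ?thesis
      using that[of 1 0] P(2) P(1)[of R] assms(2) Blue
      by (simp add: zero_enat_def[symmetric] one_enat_def)
  next
    case False
    \<comment> \<open>The affected type \<open>P\<close> is \<open>R\<close> or a third one; both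
      cases are charged to \<open>n\<close>.\<close>
    then have "part_rank R Y \<le> part_rank R X + 1"
      using P(1)[of R] P(3) by (cases "R = P") simp_all
    then show ?thesis
      using that[of 0 1] P(1)[of Q] False Blue
      by (simp add: zero_enat_def[symmetric] one_enat_def)
  qed
qed

text \<open>Sums the edge estimates. The loss of \<open>Q\<close>-rank plus the gain of
  \<open>R\<close>-rank is at most the blue-length, written without differences because ranks may be
  infinite.\<close>

lemma part_rank_path:
  assumes "network_path X es Y" "Q \<noteq> R"
  shows "part_rank Q X + part_rank R Y \<le> blue_length es + (part_rank Q Y + part_rank R X)"
  using assms(1)
proof (induction X es Y rule: network_path.induct)
  case (1 X Y)
  then show ?case by (simp add: blue_length_def)
next
  case (2 X c Z es Y)
  obtain m n :: nat where mn: "part_rank Q X \<le> part_rank Q Z + m"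
    "part_rank R Z \<le> part_rank R X + n" "m + n \<le> (if c = Blue then 1 else 0)"
    using part_rank_edge[OF _ assms(2), of c X Z] "2.prems" by auto
  have "part_rank Q X + part_rank R Y \<le> m + (part_rank Q Z + part_rank R Y)"
    using add_right_mono[OF mn(1)] by (simp add: ac_simps)
  also have "\<dots> \<le> m + (blue_length es + (part_rank Q Y + part_rank R Z))"
    using 2 by (intro add_left_mono) simp
  also have "\<dots> \<le> m + (blue_length es + (part_rank Q Y + (part_rank R X + n)))"
    by (intro add_left_mono mn)
  also have "\<dots> = (m + n + blue_length es) + (part_rank Q Y + part_rank R X)"
    by (simp add: ac_simps flip: plus_enat_simps(1))
  also have "\<dots> \<le> blue_length ((c, Z) # es) + (part_rank Q Y + part_rank R X)"
    using mn(3) by (intro add_right_mono) (auto simp: blue_length_def split: if_splits)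
  finally show ?case .
qed

text \<open>Take the types of \<open>A\<close> and \<open>B\<close> as \<open>Q\<close> and
  \<open>R\<close> in \<open>part_rank_path\<close>: the ranks on the left are the full generator
  numbers, and those on the right vanish because the parts are empty.\<close>

lemma generator_distance_ge:
  assumes "monounary_algebra A" "connected_algebra A" "monounary_algebra B" "connected_algebra B"
    "\<not> isomorphic_cores A B"
  shows "min_generators A + min_generators B \<le> generator_distance A B"
proof -
  obtain a b where ab: "a \<in> carrier A" "b \<in> carrier B"
    using assms(1,3) unfolding monounary_algebra_def by blast
  let ?Q = "return_times (oper A) a" and ?R = "return_times (oper B) b"
  have ne: "?Q \<noteq> ?R"
    using isomorphic_cores_if_return_times[OF assms(1,3) ab] assms(5) by blast
  note parts = part_connected[OF assms(2) ab(1)] part_connected[OF assms(4) ab(2)]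
  have "min_generators A + min_generators B \<le> blue_length es" if "network_path A es B" for es
    using part_rank_path[OF that ne] ne part_rank_carrier[OF assms(1), of ?Q]
      part_rank_carrier[OF assms(3), of ?R] part_rank_empty[of ?R A] part_rank_empty[of ?Q B]
    by (simp add: parts)
  then show ?thesis
    unfolding generator_distance_def by (intro INF_greatest) simp
qed

section \<open>Short paths\<close>

lemma blue_length_simps [simp]:
  "blue_length [] = 0" "blue_length (e # es) = (if fst e = Blue then 1 else 0) + blue_length es"
  "blue_length (es @ es') = blue_length es + blue_length es'"
  by (auto simp: blue_length_def)

lemma network_path_append:
  "network_path X es Y \<Longrightarrow> network_path Y es' Z \<Longrightarrow> network_path X (es @ es') Z"
  by (induction X es Y rule: network_path.induct) auto

lemma network_edge_sym: "network_edge c X Y \<Longrightarrow> network_edge c Y X"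
  unfolding network_edge_def using isomorphic_sym by (cases c) auto

lemma network_path_sym:
  "network_path X es Y \<Longrightarrow> \<exists>es'. network_path Y es' X \<and> blue_length es' = blue_length es"
proof (induction X es Y rule: network_path.induct)
  case (1 X Y)
  then show ?case by (intro exI[of _ "[]"]) simp
next
  case (2 X c Z es Y)
  then obtain es' where "network_path Y es' Z" "blue_length es' = blue_length es" by auto
  moreover have "network_path Z [(c, X)] X" using 2 network_edge_sym by auto
  ultimately show ?case
    using network_path_append[of Y es' Z] by (intro exI[of _ "es' @ [(c, X)]"]) auto
qed

lemma generator_distance_le: "network_path X es Y \<Longrightarrow> generator_distance X Y \<le> blue_length es"
  unfolding generator_distance_def by (rule INF_lower) simp

lemma generator_distance_attained:
  assumes "generator_distance X Y \<noteq> \<infinity>"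
  obtains es where "network_path X es Y" "generator_distance X Y = blue_length es"
  by (rule INF_enat_attained[OF generator_distance_def assms]) (use that in blast)

lemma generator_distance_triangle:
  "generator_distance X Z \<le> generator_distance X Y + generator_distance Y Z"
proof (cases "generator_distance X Y = \<infinity> \<or> generator_distance Y Z = \<infinity>")
  case False
  then obtain es es' where "network_path X es Y" "generator_distance X Y = blue_length es"
    "network_path Y es' Z" "generator_distance Y Z = blue_length es'"
    using generator_distance_attained by metis
  then show ?thesis
    using generator_distance_le[OF network_path_append] by fastforce
qed auto

lemma generator_distance_sym: "generator_distance X Y = generator_distance Y X"
proof -
  have "generator_distance Y X \<le> generator_distance X Y" for X Y :: "'a monounary"
  proof (cases "generator_distance X Y = \<infinity>")
    case False
    then show ?thesis
      using generator_distance_attained network_path_sym generator_distance_le by metis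
  qed simp
  then show ?thesis by (simp add: antisym)
qed

lemma generator_distance_isomorphic:
  assumes "monounary_algebra X" "monounary_algebra Y" "isomorphic X Y"
  shows "generator_distance X Y = 0"
  using generator_distance_le[of X "[(Red, Y)]" Y] assms
  by (simp add: network_edge_def zero_enat_def[symmetric])

lemma generator_distance_large:
  assumes "large_subalgebra X Y" "monounary_algebra Y"
  shows "generator_distance X Y \<le> 1"
  using generator_distance_le[of X "[(Blue, Y)]" Y] assms
  by (simp add: network_edge_def one_enat_def large_subalgebra_def subalgebra_def)

section \<open>Distances to and between one-generated algebras\<close>

lemma generator_distance_restrict:
  assumes "finite T"
  shows "generator_distance (A\<lparr>carrier := forward_closure (oper A) (insert a T)\<rparr>) (cyclic A a)
    \<le> card T"
  using assms
proof (induction T)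
  case empty
  show ?case
    using generator_distance_isomorphic[of "cyclic A a" "cyclic A a"] isomorphic_cyclic[of A a A a]
    by (simp flip: cyclic_def)
next
  case (insert t T)
  let ?X = "\<lambda>S. A\<lparr>carrier := forward_closure (oper A) S\<rparr>"
  have split: "forward_closure (oper A) (insert a (insert t T)) =
      forward_closure (oper A) (insert a T) \<union> forward_closure (oper A) {t}"
    using forward_closure_insert[of "oper A" t "insert a T"] by (simp add: insert_commute Un_commute)
  have alg: "monounary_algebra (?X (insert a T))" "monounary_algebra (?X (insert a (insert t T)))"
    by (simp_all add: monounary_algebra_restrict)
  \<comment> \<open>If \<open>t\<close> already lies in the smaller closure, the two algebras
    coincide; this is still a large subalgebra.\<close>
  have "large_subalgebra (?X (insert a T)) (?X (insert a (insert t T)))"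
    using alg split subset_forward_closure[of "{t}" "oper A"]
    by (intro large_subalgebraI[where b = t]) (auto simp: subalgebra_def)
  then have "generator_distance (?X (insert a (insert t T))) (?X (insert a T)) \<le> 1"
    using generator_distance_large[OF _ alg(2)]
    by (subst generator_distance_sym)
  then have "generator_distance (?X (insert a (insert t T))) (cyclic A a) \<le> 1 + enat (card T)"
    by (rule order_trans[OF generator_distance_triangle add_mono[OF _ insert.IH]])
  then show ?case using insert.hyps by (simp add: one_enat_def)
qed

text \<open>All generators of a minimum generating set but one are removed. The form with
  \<open>+ 1\<close> on the left avoids subtraction in \<open>enat\<close>.\<close>

lemma generator_distance_cyclic:
  assumes "monounary_algebra A"
  obtains a where "a \<in> carrier A" "generator_distance A (cyclic A a) + 1 \<le> min_generators A"
proof (cases "min_generators A = \<infinity>")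
  case True
  then show ?thesis using that assms unfolding monounary_algebra_def by auto
next
  case False
  obtain S where S: "finite S" "generates A S" "min_generators A = enat (card S)"
    by (rule INF_enat_attained[OF min_generators_def False]) blast
  have "forward_closure (oper A) S = carrier A"
    using S(2) generated_eq[OF assms] unfolding generates_def by blast
  \<comment> \<open>An empty generating set is excluded because carriers are nonempty.\<close>
  moreover from this obtain a where a: "a \<in> S"
    using assms unfolding monounary_algebra_def by (auto simp: forward_closure_def)
  ultimately have "generator_distance A (cyclic A a) \<le> card (S - {a})"
    using generator_distance_restrict[of "S - {a}" A a] S(1) by (simp add: insert_absorb)
  then have "generator_distance A (cyclic A a) + 1 \<le> enat (card (S - {a})) + 1"
    by (rule add_right_mono)
  also have "\<dots> = enat (card S)"
    by (simp only: card_Suc_Diff1[OF S(1) a, symmetric] one_enat_def plus_enat_simps Suc_eq_plus1)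
  finally show ?thesis using that a S unfolding generates_def by auto
qed

lemma generator_distance_cyclic_same_core:
  fixes A B :: "'u monounary"
  assumes "return_times (oper A) a = return_times (oper B) b"
  shows "generator_distance (cyclic A a) (cyclic B b) \<le> 1"
proof -
  \<comment> \<open>Stated for arbitrary algebras, so that it can be applied with the roles
    exchanged when the tail of \<open>a\<close> is the longer one.\<close>
  have shorter: "generator_distance (cyclic A a) (cyclic B b) \<le> 1"
    if A: "rho_shaped (oper A) a s n"
      and B: "rho_shaped (oper B) b t n"
      and "s \<le> t" for A B :: "'u monounary" and a b s t n
  proof -
    \<comment> \<open>Dropping \<open>t - s\<close> points leaves a tail of length \<open>s\<close>,
      as for \<open>a\<close>. For \<open>n = 0\<close> the values \<open>s\<close> and
      \<open>t\<close> carry no information, but any later point of an infinite orbit serves equally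
      well.\<close>
    let ?c = "(oper B ^^ (t - s)) b"
    have pow: "(oper B ^^ i) ?c = (oper B ^^ (i + (t - s))) b" for i
      by (simp add: funpow_add)
    have "t \<le> i + (t - s) \<longleftrightarrow> s \<le> i" for i
      using \<open>s \<le> t\<close> by auto
    then have "isomorphic (cyclic A a) (cyclic B ?c)"
      using A B unfolding rho_shaped_def
      by (intro isomorphic_cyclic) (simp add: pow cong_add_rcancel_nat)
    then have 1: "generator_distance (cyclic A a) (cyclic B ?c) = 0"
      by (simp add: generator_distance_isomorphic)
    have "forward_closure (oper B) {?c} \<subseteq> forward_closure (oper B) {b}"
      by (intro forward_closure_minimal forward_closure_closed)
        (simp add: funpow_in_forward_closure)
    then have "large_subalgebra (cyclic B ?c) (cyclic B b)"
      using subset_forward_closure[of "{b}" "oper B"]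
      by (intro large_subalgebraI[where b = b]) (auto simp: subalgebra_def)
    then show ?thesis
      using generator_distance_large[of "cyclic B ?c" "cyclic B b"] 1
        generator_distance_triangle[of "cyclic A a" "cyclic B b" "cyclic B ?c"] by simp
  qed
  obtain s t n where
    A: "rho_shaped (oper A) a s n"
    and B: "rho_shaped (oper B) b t n"
    using rho_shaped_same_cycle[OF assms] by metis
  show ?thesis
    using shorter[OF A B] shorter[OF B A] generator_distance_sym by (metis nle_le)
qed

text \<open>The disjoint union of the two algebras is the middle vertex. It is built in the sum type
  and must be moved back into \<open>'u\<close> to be a vertex of the network.\<close>

lemma generator_distance_cyclic_le_2:
  fixes A B :: "'u monounary"
  assumes "infinite (UNIV :: 'u set)"
  shows "generator_distance (cyclic A a) (cyclic B b) \<le> 2"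
proof -
  define f where "f = map_sum (oper A) (oper B)"
  define D where "D S = \<lparr>carrier = forward_closure f S, oper = f\<rparr>" for S
  have f_pow: "(f ^^ k) (Inl x) = Inl ((oper A ^^ k) x)" "(f ^^ k) (Inr y) = Inr ((oper B ^^ k) y)"
    for k x y by (induction k) (auto simp: f_def)
  have D: "carrier (D S) = forward_closure f S" "oper (D S) = f" for S
    by (simp_all add: D_def)
  have alg: "monounary_algebra (D S)" if "S \<noteq> {}" for S
    using monounary_algebra_restrict[OF that, of "\<lparr>carrier = {}, oper = f\<rparr>"] by (simp add: D_def)
  \<comment> \<open>Brings \<open>D {x}\<close> into the shape to which
    \<open>isomorphic_cyclic\<close> applies.\<close>
  have cyc: "D {x} = cyclic (D {x}) x" for x
    by (simp add: D_def cyclic_def)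
  have isoA: "isomorphic (cyclic A a) (D {Inl a})" and isoB: "isomorphic (cyclic B b) (D {Inr b})"
    by (subst cyc, rule isomorphic_cyclic, simp add: D f_pow)+
  let ?U = "D {Inl a, Inr b}"
  have split: "forward_closure f {Inl a, Inr b} = forward_closure f {Inl a} \<union> forward_closure f {Inr b}"
    by (rule forward_closure_insert)
  have large: "large_subalgebra (D {Inl a}) ?U" "large_subalgebra (D {Inr b}) ?U"
    using alg split subset_forward_closure[of "{Inl a, Inr b}" f]
    by (auto intro!: large_subalgebraI[where b = "Inr b"]
        large_subalgebraI[where b = "Inl a" and X = "D {Inr b}"]
        simp: subalgebra_def D)
  \<comment> \<open>Two orbits form a countable set, which embeds into the infinite type
    \<open>'u\<close> by way of the natural numbers.\<close>
  have "countable (carrier ?U)" by (simp add: D countable_forward_closure)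
  then obtain g :: "'u + 'u \<Rightarrow> nat" where g: "inj_on g (carrier ?U)"
    unfolding countable_def by blast
  obtain e :: "nat \<Rightarrow> 'u" where e: "inj e"
    using assms infinite_countable_subset by blast
  define h where "h = e \<circ> g"
  have h: "inj_on h (carrier ?U)"
    unfolding h_def using g e by (meson comp_inj_on inj_on_subset subset_UNIV)
  let ?V = "image_algebra h ?U"
  have V: "monounary_algebra ?V" by (rule image_algebra(1)[OF alg h]) simp
  \<comment> \<open>A red edge leads to the copy of \<open>D {x}\<close> under \<open>h\<close>, and
    one blue edge from there to the copy of the union.\<close>
  have step: "generator_distance (cyclic C c) ?V \<le> 1"
    if "isomorphic (cyclic C c) (D {x})" "large_subalgebra (D {x}) ?U" for C :: "'u monounary" and c x
  proof -
    have "inj_on h (carrier (D {x}))"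
      using h that(2) unfolding large_subalgebra_def subalgebra_def by (meson inj_on_subset)
    note im = image_algebra[OF alg this, simplified]
    have "generator_distance (cyclic C c) (image_algebra h (D {x})) = 0"
      using isomorphic_trans[OF that(1) im(2)] im(1) by (intro generator_distance_isomorphic) auto
    moreover have "generator_distance (image_algebra h (D {x})) ?V \<le> 1"
      using generator_distance_large[OF large_subalgebra_image[OF that(2) alg h] V] by simp
    ultimately show ?thesis
      using generator_distance_triangle[of "cyclic C c" ?V "image_algebra h (D {x})"] by simp
  qed
  have "generator_distance (cyclic A a) (cyclic B b) \<le>
      generator_distance (cyclic A a) ?V + generator_distance (cyclic B b) ?V"
    using generator_distance_triangle generator_distance_sym by metis
  also have "\<dots> \<le> 1 + 1"
    by (intro add_mono step[OF isoA large(1)] step[OF isoB large(2)])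
  finally show ?thesis by (simp add: one_add_one)
qed

theorem proposition3p6:
  fixes A B :: "'u monounary"
  assumes "infinite (UNIV :: 'u set)"
    and "monounary_algebra A" "connected_algebra A"
    and "monounary_algebra B" "connected_algebra B"
  shows "(isomorphic_cores A B \<longrightarrow>
            generator_distance A B \<le> min_generators A + min_generators B - 1) \<and>
         (\<not> isomorphic_cores A B \<longrightarrow>
            generator_distance A B = min_generators A + min_generators B)"
proof -
  obtain a b where a: "a \<in> carrier A" "generator_distance A (cyclic A a) + 1 \<le> min_generators A"
    and b: "b \<in> carrier B" "generator_distance B (cyclic B b) + 1 \<le> min_generators B"
    using generator_distance_cyclic assms(2,4) by metis
  let ?x = "generator_distance A (cyclic A a)" and ?y = "generator_distance B (cyclic B b)"
  have via: "generator_distance A B \<le> ?x + generator_distance (cyclic A a) (cyclic B b) + ?y"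
    using generator_distance_triangle generator_distance_sym add_right_mono order_trans by metis
  have sum: "(?x + 1) + (?y + 1) \<le> min_generators A + min_generators B"
    by (rule add_mono[OF a(2) b(2)])
  have "generator_distance A B \<le> min_generators A + min_generators B - 1" if "isomorphic_cores A B"
  proof -
    have "generator_distance (cyclic A a) (cyclic B b) \<le> 1"
      using generator_distance_cyclic_same_core
        return_times_if_isomorphic_cores[OF that assms(3,5) a(1) b(1)] by metis
    then have "generator_distance A B \<le> ?x + 1 + ?y"
      using via by (meson add_left_mono add_right_mono order_trans)
    \<comment> \<open>If the sum of the generator numbers is \<infinity>, so is the bound; otherwise
      \<open>?x\<close> and \<open>?y\<close> are finite and one unit can be subtracted.\<close>
    then show ?thesis
      using sum
      by (cases "min_generators A + min_generators B"; cases ?x; cases ?y;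
          cases "generator_distance A B")
        (auto simp: one_enat_def)
  qed
  moreover have "generator_distance A B = min_generators A + min_generators B"
    if "\<not> isomorphic_cores A B"
  proof (rule antisym)
    have "generator_distance A B \<le> ?x + 2 + ?y"
      using via generator_distance_cyclic_le_2[OF assms(1), of A a B b]
      by (meson add_left_mono add_right_mono order_trans)
    also have "\<dots> = (?x + 1) + (?y + 1)"
      by (simp add: ac_simps one_add_one[symmetric] del: one_add_one)
    finally show "generator_distance A B \<le> min_generators A + min_generators B"
      using sum by (rule order_trans)
  qed (rule generator_distance_ge[OF assms(2-5) that])
  ultimately show ?thesis by blast
qed

end
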